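(* Let $(X,d_X)$ and $(\Theta,d_\Theta)$ be compact metric spaces and let $\omega$ be a modulus of continuity. For every $N\ge 2$ let $\Theta_N=\{\theta_1^N,\dots,\theta_N^N\}\subset\Theta$ be a finite set of types and let $J^N:\Theta_N\times X\times X^{N-1}\to\mathbb{R}$ be a function that is symmetric in its last $N-1$ variables and such that, for every $N$, all $\theta,\theta'\in\Theta_N$, all $x,y\in X$ and all $z=(z_1,\dots,z_{N-1})$, $w=(w_1,\dots,w_{N-1})$ in $X^{N-1}$, $$|J^N(\theta,x,z)-J^N(\theta',y,w)|\le \omega(d_\Theta(\theta,\theta'))+\omega(d_X(x,y))+\omega\Big(\mathcal{W}_1\Big(\tfrac1{N-1}\sum_{k=1}^{N-1}\delta_{z_k},\tfrac1{N-1}\sum_{k=1}^{N-1}\delta_{w_k}\Big)\Big).$$ Let $F^N:\Theta\times X\times\mathcal{P}(X)\to\mathbb{R}$ be the extension of $J^N$ given by $$F^N(\theta,x,\nu)=\inf_{(z,\theta')\in X^{N-1}\times\Theta_N}\Big\{J^N(\theta',x,z)+\omega(d_\Theta(\theta',\theta))+\omega\Big(\mathcal{W}_1\Big(\nu,\tfrac1{N-1}\sum_{k=1}^{N-1}\delta_{z_k}\Big)\Big)\Big\}.$$ For every $N$ consider the $N$-person game in which every player has strategy space $X$ and the cost of player $i\in\{1,\dots,N\}$ is $$J_i^N(x_i,x_{-i})=J^N(\theta_i^N,x_i,x_{-i})=F^N\Big(\theta_i^N,x_i,\tfrac1{N-1}\sum_{j\ne i}\delta_{x_j}\Big).$$ Let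 $\overline{x}^N=(x_1^N,\dots,x_N^N)\in X^N$ be a Nash equilibrium of this game and set $$\mu^N:=\frac1N\sum_{i=1}^N\delta_{\theta_i^N},\qquad \nu^N:=\frac1N\sum_{i=1}^N\delta_{x_i^N},\qquad \gamma^N:=\frac1N\sum_{i=1}^N\delta_{(\theta_i^N,x_i^N)}.$$ Assume that, along some subsequence of $N\to\infty$, $\mu^N\to\mu$, $\nu^N\to\nu$ and $\gamma^N\to\gamma$ weakly-$*$ in $\mathcal{P}(\Theta)$, $\mathcal{P}(X)$ and $\mathcal{P}(\Theta\times X)$ respectively, and $F^N\to F$ in $\mathcal{C}(\Theta\times X\times\mathcal{P}(X))$. Then $\gamma$ is a Cournot-Nash equilibrium for $F$ and $\mu$.
   Context: For a compact metric space $Y$, $\mathcal{P}(Y)$ is the set of Borel probability measures on $Y$ with the weak-$*$ topology, which is metrized by the 1-Wasserstein distance $\mathcal{W}_1(\alpha,\beta)=\inf_{\gamma\in\Pi(\alpha,\beta)}\int_{Y\times Y}d_Y(x,y)\,\gamma(dx,dy)$, where $\Pi(\alpha,\beta)$ is the set of probability measures on $Y\times Y$ with marginals $\alpha$ and $\beta$. $\mathcal{C}(\cdot)$ denotes the space of real-valued continuous functions on a compact space, with uniform convergence. A modulus of continuity is a nondecreasing function $\omega:[0,\infty)\to[0,\infty)$ with $\omega(0)=0$ and $\omega(t)\to0$ as $t\to0^+$. For $x\in X^N$, $x_{-i}=(x_j)_{j\neq i}\in X^{N-1}$. A Nash equilibrium of an $N$-person game in which player $i$ has strategy space $X_i$ and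 cost $J_i$ is a profile $(\overline{x}_1,\dots,\overline{x}_N)$ such that $J_i(\overline{x}_i,\overline{x}_{-i})\le J_i(x_i,\overline{x}_{-i})$ for every $i$ and every $x_i\in X_i$ (players minimise costs). Given $F\in\mathcal{C}(\Theta\times X\times\mathcal{P}(X))$ and $\mu\in\mathcal{P}(\Theta)$, a Cournot-Nash equilibrium for $F$ and $\mu$ is a $\gamma\in\mathcal{P}(\Theta\times X)$ whose first marginal is $\mu$ and such that, denoting by $\nu$ the second marginal of $\gamma$, $$\gamma\big(\{(\theta,x)\in\Theta\times X: F(\theta,x,\nu)=\min_{y\in X}F(\theta,y,\nu)\}\big)=1.$$ *)

theory Defs
  imports "HOL-Probability.Probability"
begin

definition borel_probs :: "'a::topological_space measure set" where
  "borel_probs = {M. sets M = sets borel \<and> prob_space M}"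

text \<open>The coarsest topology on the Borel probability measures that makes integration against
  every continuous function continuous. It is meant for compact underlying spaces, where a
  continuous function is bounded, hence integrable.\<close>

definition weak_star :: "'a::topological_space measure topology" where
  "weak_star = topology_generated_by
     {{M \<in> borel_probs. integral\<^sup>L M f \<in> U} | (f :: 'a \<Rightarrow> real) U.
        continuous_on UNIV f \<and> open U}"

lemma topspace_weak_star [simp]: "topspace weak_star = borel_probs"
proof -
  have "borel_probs \<in> {{M \<in> borel_probs. integral\<^sup>L M f \<in> U} | (f :: 'a \<Rightarrow> real) U.
      continuous_on UNIV f \<and> open U}"
    by (rule CollectI, rule exI[of _ "\<lambda>_. 0"], rule exI[of _ UNIV]) auto
  then show ?thesis
    unfolding weak_star_def topology_generated_by_topspace by blast
qed

lemma limitin_weak_star_iff: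
  "limitin weak_star M L F \<longleftrightarrow>
     L \<in> borel_probs \<and> (\<forall>\<^sub>F k in F. M k \<in> borel_probs) \<and>
     (\<forall>f :: 'a::topological_space \<Rightarrow> real. continuous_on UNIV f \<longrightarrow>
        ((\<lambda>k. integral\<^sup>L (M k) f) \<longlongrightarrow> integral\<^sup>L L f) F)"
  (is "?lhs \<longleftrightarrow> ?rhs")
proof
  assume lim: ?lhs
  have ev: "\<forall>\<^sub>F k in F. M k \<in> borel_probs \<and> integral\<^sup>L (M k) f \<in> U"
    if "continuous_on UNIV f" "open U" "integral\<^sup>L L f \<in> U" for f :: "'a \<Rightarrow> real" and U
  proof -
    have "openin weak_star {M \<in> borel_probs. integral\<^sup>L M f \<in> U}"
      unfolding weak_star_def using that by (intro topology_generated_by_Basis) blast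
    then show ?thesis
      using lim that unfolding limitin_def by fastforce
  qed
  have "\<forall>\<^sub>F k in F. M k \<in> borel_probs"
    using ev[of "\<lambda>_. 0" UNIV] by simp
  moreover have "((\<lambda>k. integral\<^sup>L (M k) f) \<longlongrightarrow> integral\<^sup>L L f) F"
    if "continuous_on UNIV f" for f :: "'a \<Rightarrow> real"
  proof (rule topological_tendstoI)
    fix U assume "open U" "integral\<^sup>L L f \<in> U"
    from ev[OF that this] show "\<forall>\<^sub>F k in F. integral\<^sup>L (M k) f \<in> U"
      by (rule eventually_mono) simp
  qed
  ultimately show ?rhs
    using lim by (simp add: limitin_def)
next
  assume r: ?rhs
  let ?B = "{{M \<in> borel_probs. integral\<^sup>L M f \<in> U} | (f :: 'a \<Rightarrow> real) U.
      continuous_on UNIV f \<and> open U}"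
  have "\<forall>\<^sub>F k in F. M k \<in> V" if "generate_topology_on ?B V" "L \<in> V" for V
    using that
  proof (induction rule: generate_topology_on.induct)
    case Empty
    then show ?case by simp
  next
    case (Int a b)
    then show ?case by (auto intro: eventually_conj)
  next
    case (UN K)
    then obtain k where "k \<in> K" "L \<in> k" by blast
    with UN have "\<forall>\<^sub>F x in F. M x \<in> k" by blast
    then show ?case by (rule eventually_mono) (use \<open>k \<in> K\<close> in blast)
  next
    case (Basis s)
    then obtain f :: "'a \<Rightarrow> real" and U where
      s: "s = {M \<in> borel_probs. integral\<^sup>L M f \<in> U}" "continuous_on UNIV f" "open U"
      by blast
    then have "\<forall>\<^sub>F k in F. integral\<^sup>L (M k) f \<in> U"
      using r Basis.prems by (auto dest: topological_tendstoD)
    with r show ?case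
      unfolding s by (auto elim: eventually_elim2)
  qed
  then show ?lhs
    using r by (auto simp: limitin_def) (simp add: weak_star_def openin_topology_generated_by_iff)
qed

definition couplings ::
  "'a::topological_space measure \<Rightarrow> 'b::topological_space measure \<Rightarrow> ('a \<times> 'b) measure set" where
  "couplings \<alpha> \<beta> = {\<gamma> \<in> borel_probs. distr \<gamma> borel fst = \<alpha> \<and> distr \<gamma> borel snd = \<beta>}"

definition wasserstein1 :: "'a::metric_space measure \<Rightarrow> 'a measure \<Rightarrow> real" where
  "wasserstein1 \<alpha> \<beta> = (INF \<gamma> \<in> couplings \<alpha> \<beta>. \<integral>p. dist (fst p) (snd p) \<partial>\<gamma>)"

definition conv_in_C :: "'a topology \<Rightarrow> (nat \<Rightarrow> 'a \<Rightarrow> real) \<Rightarrow> ('a \<Rightarrow> real) \<Rightarrow> bool" where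
  "conv_in_C T f g \<longleftrightarrow>
     (\<forall>n. continuous_map T euclideanreal (f n)) \<and> continuous_map T euclideanreal g \<and>
     uniform_limit (topspace T) f g sequentially"

definition modulus_of_continuity :: "(real \<Rightarrow> real) \<Rightarrow> bool" where
  "modulus_of_continuity \<omega> \<longleftrightarrow>
     (\<forall>t\<ge>0. 0 \<le> \<omega> t) \<and> mono_on {0..} \<omega> \<and> \<omega> 0 = 0 \<and> (\<omega> \<longlongrightarrow> 0) (at_right 0)"

text \<open>Points of \<open>X\<^sup>n\<close> are lists of length \<open>n\<close>, with coordinates numbered from 0.\<close>

definition empirical :: "'a::topological_space list \<Rightarrow> 'a measure" where
  "empirical z = measure_of UNIV (sets borel)
     (\<lambda>A. (\<Sum>k<length z. emeasure (return borel (z ! k)) A) / of_nat (length z))"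

lemma sets_empirical [simp]: "sets (empirical z) = sets borel"
  unfolding empirical_def using sets.sigma_sets_eq[of borel] sets.space_closed[of borel]
  by (simp add: sets_measure_of_conv)

lemma emeasure_empirical:
  assumes A: "A \<in> sets borel"
  shows "emeasure (empirical z) A =
    (\<Sum>k<length z. emeasure (return borel (z ! k)) A) / of_nat (length z)"
proof (rule emeasure_measure_of[OF empirical_def])
  show "positive (sets (empirical z))
     (\<lambda>A. (\<Sum>k<length z. emeasure (return borel (z ! k)) A) / of_nat (length z))"
    by (simp add: positive_def)
  show "countably_additive (sets (empirical z))
     (\<lambda>A. (\<Sum>k<length z. emeasure (return borel (z ! k)) A) / of_nat (length z))"
  proof (unfold countably_additive_def, intro allI impI)
    fix A :: "nat \<Rightarrow> 'a set"
    assume "range A \<subseteq> sets (empirical z)" and disj: "disjoint_family A"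
    then have "range A \<subseteq> sets (return borel (z ! k))" for k
      by simp
    then have "(\<Sum>i. emeasure (return borel (z ! k)) (A i)) =
        emeasure (return borel (z ! k)) (\<Union> (range A))" for k
      using disj by (rule suminf_emeasure)
    then show "(\<Sum>i. (\<Sum>k<length z. emeasure (return borel (z ! k)) (A i)) / of_nat (length z)) =
        (\<Sum>k<length z. emeasure (return borel (z ! k)) (\<Union> (range A))) / of_nat (length z)"
      by (simp add: suminf_sum ennreal_suminf_divide del: emeasure_return)
  qed
qed (use A in auto)

definition others :: "nat \<Rightarrow> 'a list \<Rightarrow> 'a list" where
  "others i x = take i x @ drop (Suc i) x"

text \<open>\<open>S i\<close> is the strategy space of player \<open>i < N\<close>, and \<open>J i y (others i x)\<close> is her cost when she
  plays \<open>y\<close> against \<open>x\<close>.\<close>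

definition nash_equilibrium ::
  "nat \<Rightarrow> (nat \<Rightarrow> 'a set) \<Rightarrow> (nat \<Rightarrow> 'a \<Rightarrow> 'a list \<Rightarrow> real) \<Rightarrow> 'a list \<Rightarrow> bool" where
  "nash_equilibrium N S J x \<longleftrightarrow>
     length x = N \<and> (\<forall>i<N. x ! i \<in> S i) \<and>
     (\<forall>i<N. \<forall>y\<in>S i. J i (x ! i) (others i x) \<le> J i y (others i x))"

definition cost_extension ::
  "(real \<Rightarrow> real) \<Rightarrow> nat \<Rightarrow> 't::metric_space set \<Rightarrow> ('t \<Rightarrow> 'x::metric_space \<Rightarrow> 'x list \<Rightarrow> real) \<Rightarrow>
    't \<times> 'x \<times> 'x measure \<Rightarrow> real" where
  "cost_extension \<omega> N T J = (\<lambda>(\<theta>, x, \<nu>).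
     INF (z, \<theta>') \<in> {z. length z = N - 1} \<times> T.
       J \<theta>' x z + \<omega> (dist \<theta>' \<theta>) + \<omega> (wasserstein1 \<nu> (empirical z)))"

abbreviation type_action_measure_space ::
  "('t::topological_space \<times> 'x::topological_space \<times> 'x measure) topology" where
  "type_action_measure_space \<equiv> prod_topology euclidean (prod_topology euclidean weak_star)"

text \<open>For compact \<open>X\<close> and continuous \<open>F\<close> the infimum below is attained, hence a minimum.\<close>

definition cournot_nash_equilibrium ::
  "('t::topological_space \<times> 'x::topological_space \<times> 'x measure \<Rightarrow> real) \<Rightarrow> 't measure \<Rightarrow>
    ('t \<times> 'x) measure \<Rightarrow> bool" where
  "cournot_nash_equilibrium F \<mu> \<gamma> \<longleftrightarrow>
     \<gamma> \<in> borel_probs \<and> distr \<gamma> borel fst = \<mu> \<and>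
     (let \<nu> = distr \<gamma> borel snd
      in measure \<gamma> {(\<theta>, x). F (\<theta>, x, \<nu>) = (INF y. F (\<theta>, y, \<nu>))} = 1)"

end

theory Submission
  imports Defs
begin

text \<open>The extension \<open>F\<^sup>N\<close> agrees with \<open>J\<^sup>N\<close> on empirical measures, so the Nash property says that
  \<open>x\<^sub>i\<close> minimises \<open>F\<^sup>N (\<theta>\<^sub>i, \<cdot>, m\<^sub>i)\<close>, where \<open>m\<^sub>i\<close> is the empirical measure of the other players.
  Dropping one of \<open>N\<close> players changes the empirical measure by \<open>O(1/N)\<close>, hence \<open>m\<^sub>i \<rightarrow> \<nu>\<close> uniformly
  in \<open>i\<close>; by compactness of \<open>\<Theta> \<times> X\<close> the regret
  \<open>g (\<theta>, x) = F (\<theta>, x, \<nu>) - (INF y. F (\<theta>, y, \<nu>))\<close> at \<open>(\<theta>\<^sub>i, x\<^sub>i)\<close> tends to 0 uniformly in \<open>i\<close>.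
  As \<open>g\<close> is continuous and nonnegative, its \<open>\<gamma>\<close>-integral is the limit of the averages of
  \<open>g (\<theta>\<^sub>i, x\<^sub>i)\<close>, so it vanishes and \<open>g = 0\<close> holds \<open>\<gamma>\<close>-almost everywhere.\<close>

section \<open>Continuous functions as test functions for Borel probability measures\<close>

lemma continuous_on_UNIV_bounded:
  fixes f :: "'a::topological_space \<Rightarrow> real"
  assumes "compact (UNIV :: 'a set)" "continuous_on UNIV f"
  obtains B where "\<And>x. \<bar>f x\<bar> \<le> B"
proof -
  have "bounded (range f)"
    using assms by (intro compact_imp_bounded compact_continuous_image) auto
  then show thesis
    using that by (auto simp: bounded_real)
qed

lemma integrable_continuous_borel_probs:
  fixes f :: "'a::topological_space \<Rightarrow> real"
  assumes "compact (UNIV :: 'a set)" "continuous_on UNIV f" "M \<in> borel_probs"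
  shows "integrable M f"
proof -
  interpret prob_space M
    using assms(3) by (simp add: borel_probs_def)
  obtain B where "\<And>x. \<bar>f x\<bar> \<le> B"
    using continuous_on_UNIV_bounded[OF assms(1,2)] by blast
  moreover have "f \<in> borel_measurable M"
    using borel_measurable_continuous_onI[OF assms(2)] assms(3)
    by (simp add: borel_probs_def cong: measurable_cong_sets)
  ultimately show ?thesis
    by (intro integrable_const_bound[of _ B]) auto
qed

lemma distr_borel_probs:
  assumes "M \<in> borel_probs" "continuous_on UNIV g"
  shows "distr M borel g \<in> borel_probs"
    and "continuous_on UNIV f \<Longrightarrow>
      integral\<^sup>L (distr M borel g) f = integral\<^sup>L M (\<lambda>x. f (g x) :: real)"
proof -
  have g: "g \<in> M \<rightarrow>\<^sub>M borel"
    using borel_measurable_continuous_onI[OF assms(2)] assms(1)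
    by (simp add: borel_probs_def cong: measurable_cong_sets)
  show "distr M borel g \<in> borel_probs"
    using prob_space.prob_space_distr[OF _ g] assms(1) by (simp add: borel_probs_def)
  show "integral\<^sup>L (distr M borel g) f = integral\<^sup>L M (\<lambda>x. f (g x) :: real)"
    if "continuous_on UNIV f"
    using g that by (intro integral_distr borel_measurable_continuous_onI)
qed

text \<open>The indicator of a closed set \<open>C\<close> is the pointwise limit of the continuous functions
  \<open>max 0 (1 - n * infdist x C)\<close>.\<close>

lemma borel_probs_eqI:
  fixes M N :: "'a::metric_space measure"
  assumes M: "M \<in> borel_probs" and N: "N \<in> borel_probs"
    and eq: "\<And>f :: 'a \<Rightarrow> real. continuous_on UNIV f \<Longrightarrow> integral\<^sup>L M f = integral\<^sup>L N f"
  shows "M = N"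
proof -
  have lim: "(\<lambda>n. integral\<^sup>L K (\<lambda>x. max 0 (1 - real n * infdist x C))) \<longlonglongrightarrow> measure K C"
    if K: "K \<in> borel_probs" and C: "closed C" "C \<noteq> {}" for K and C :: "'a set"
  proof -
    interpret prob_space K
      using K by (simp add: borel_probs_def)
    have sets_K [measurable_cong]: "sets K = sets borel"
      using K by (simp add: borel_probs_def)
    have [measurable]: "C \<in> sets borel"
      using C by simp
    have "(\<lambda>n. integral\<^sup>L K (\<lambda>x. max 0 (1 - real n * infdist x C))) \<longlonglongrightarrow>
        integral\<^sup>L K (indicator C)"
    proof (rule integral_dominated_convergence[where w = "\<lambda>_. 1"])
      show "(\<lambda>x. max 0 (1 - real n * infdist x C)) \<in> borel_measurable K" for n
      proof -
        have "continuous_on UNIV (\<lambda>x. max 0 (1 - real n * infdist x C))"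
          by (intro continuous_intros)
        then show ?thesis
          using borel_measurable_continuous_onI sets_K by (simp cong: measurable_cong_sets)
      qed
      show "AE x in K. (\<lambda>n. max 0 (1 - real n * infdist x C)) \<longlonglongrightarrow> indicator C x"
      proof (rule AE_I2)
        fix x
        show "(\<lambda>n. max 0 (1 - real n * infdist x C)) \<longlonglongrightarrow> indicator C x"
        proof (cases "x \<in> C")
          case True
          then show ?thesis by simp
        next
          case False
          then have pos: "infdist x C > 0"
            using C in_closed_iff_infdist_zero infdist_nonneg by (metis less_eq_real_def)
          \<comment> \<open>From \<open>n0\<close> on, the slope exceeds the reciprocal of the
            distance from \<open>x\<close> to \<open>C\<close>, so the ramp function is exactly 0 at
            \<open>x\<close>.\<close>
          obtain n0 :: nat where "1 / infdist x C < real n0"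
            using reals_Archimedean2 by blast
          then have n0: "1 < real n0 * infdist x C"
            using pos by (simp add: field_simps)
          have "max 0 (1 - real n * infdist x C) = indicator C x" if "n \<ge> n0" for n
          proof -
            have "real n0 * infdist x C \<le> real n * infdist x C"
              using that pos by (intro mult_right_mono) auto
            then show ?thesis
              using n0 False by simp
          qed
          then show ?thesis
            by (intro tendsto_eventually eventually_sequentiallyI)
        qed
      qed
    qed (auto simp: max_def infdist_nonneg)
    then show ?thesis
      using sets_K by simp
  qed
  have closed_eq: "emeasure M C = emeasure N C" if "closed C" for C
  \<comment> \<open>By convention \<open>infdist x {}\<close> is 0, so for the empty set the ramp
    functions would be constantly 1; this case is treated separately.\<close>
  proof (cases "C = {}")
    case False
    have cont: "continuous_on UNIV (\<lambda>x. max 0 (1 - real n * infdist x C))" for n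
      by (intro continuous_intros)
    have "measure M C = measure N C"
      using lim[OF M that False] lim[OF N that False] unfolding eq[OF cont]
      by (rule LIMSEQ_unique)
    then show ?thesis
      using M N by (simp add: borel_probs_def finite_measure.emeasure_eq_measure prob_space_def)
  qed simp
  have sets_eq: "sets K = sigma_sets UNIV (Collect closed)" if "K \<in> borel_probs"
    for K :: "'a measure"
    using that by (simp add: borel_probs_def borel_eq_closed)
  show ?thesis
  \<comment> \<open>Closed sets are stable under intersection and generate the Borel sets, so
    agreement on them settles equality. The whole space, being closed and of finite measure, serves
    as the exhausting sequence.\<close>
  proof (rule measure_eqI_generator_eq[of "Collect closed" UNIV M N "\<lambda>_. UNIV"])
    show "emeasure M UNIV \<noteq> \<infinity>"
      using M by (simp add: borel_probs_def finite_measure.emeasure_finite prob_space_def)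
  qed (use closed_eq sets_eq M N in \<open>auto simp: Int_stable_def\<close>)
qed

section \<open>Empirical measures as images of uniform measures\<close>

text \<open>The uniform measure lives on indices rather than points, so repeated entries keep their
  multiplicity. Total mass and integrals of empirical measures then follow by change of
  variables.\<close>

lemma empirical_eq_distr:
  assumes "z \<noteq> []"
  shows "empirical z = distr (uniform_count_measure {..<length z}) borel ((!) z)"
proof (rule measure_eqI)
  fix A assume "A \<in> sets (empirical z)"
  then have A: "A \<in> sets borel" by simp
  have "(\<Sum>k<length z. indicator A (z ! k)) = (of_nat (card ((!) z -` A \<inter> {..<length z})) :: ennreal)"
  proof -
    have "(\<Sum>k<length z. indicator A (z ! k)) =
        (\<Sum>k<length z. indicator ((!) z -` A) k :: ennreal)"
      by (intro sum.cong) (auto simp: indicator_def)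
    then show ?thesis
      by (simp add: sum.If_cases indicator_def[abs_def] Int_commute vimage_def)
  qed
  then show "emeasure (empirical z) A =
      emeasure (distr (uniform_count_measure {..<length z}) borel ((!) z)) A"
    using assms A
    by (subst emeasure_distr)
      (auto simp: emeasure_empirical emeasure_uniform_count_measure space_uniform_count_measure
        sets_uniform_count_measure measurable_def divide_ennreal ennreal_of_nat_eq_real_of_nat)
qed simp

lemma empirical_in_borel_probs:
  assumes "z \<noteq> []"
  shows "empirical z \<in> borel_probs"
proof -
  have "prob_space (uniform_count_measure {..<length z})"
    using assms by (intro prob_space_uniform_count_measure) auto
  then have "prob_space (empirical z)"
    unfolding empirical_eq_distr[OF assms]
    by (rule prob_space.prob_space_distr)
      (auto simp: measurable_def space_uniform_count_measure sets_uniform_count_measure)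
  then show ?thesis
    by (simp add: borel_probs_def)
qed

lemma integral_empirical:
  fixes f :: "'a::topological_space \<Rightarrow> real"
  assumes "z \<noteq> []" "continuous_on UNIV f"
  shows "integral\<^sup>L (empirical z) f = sum_list (map f z) / real (length z)"
proof -
  have "integral\<^sup>L (empirical z) f = (\<Sum>k<length z. f (z ! k)) / real (length z)"
    unfolding empirical_eq_distr[OF assms(1)]
    by (subst integral_distr)
      (auto simp: integral_uniform_count_measure measurable_def space_uniform_count_measure
        sets_uniform_count_measure
        intro: measurable_sets_borel[OF borel_measurable_continuous_onI[OF assms(2)]])
  then show ?thesis
    by (simp add: sum_list_sum_nth atLeast0LessThan)
qed

section \<open>The Wasserstein distance and the extended cost\<close>

text \<open>The image of \<open>M\<close> under the diagonal map is a coupling of \<open>M\<close>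
  with itself whose transport cost is 0.\<close>

lemma wasserstein1_self:
  assumes "M \<in> borel_probs"
  shows "wasserstein1 M M = 0"
proof -
  let ?D = "distr M borel (\<lambda>x. (x, x))"
  have diag: "continuous_on UNIV (\<lambda>x::'a. (x, x))"
    by (intro continuous_intros)
  have M: "sets M = sets borel"
    using assms by (simp add: borel_probs_def)
  have meas: "(\<lambda>x. (x, x)) \<in> M \<rightarrow>\<^sub>M borel"
    using borel_measurable_continuous_onI[OF diag] M by (simp cong: measurable_cong_sets)
  have "distr ?D borel fst = M" "distr ?D borel snd = M"
    using M meas
    by (simp_all add: distr_distr o_def borel_measurable_continuous_onI
        continuous_on_fst continuous_on_snd distr_id2)
  then have "?D \<in> couplings M M"
    using distr_borel_probs(1)[OF assms diag] by (simp add: couplings_def)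
  moreover have "(\<integral>p. dist (fst p) (snd p) \<partial>?D) = 0"
    by (subst distr_borel_probs(2)[OF assms diag]) (auto intro!: continuous_intros)
  moreover have "bdd_below ((\<lambda>\<gamma>. \<integral>p. dist (fst p) (snd p) \<partial>\<gamma>) ` couplings M M)"
    by (rule bdd_belowI2[where m = 0]) simp
  ultimately have "wasserstein1 M M \<le> 0"
    unfolding wasserstein1_def by (metis (lifting) cINF_lower)
  \<comment> \<open>Nonnegativity of the infimum requires the set of couplings to be nonempty; the
    diagonal coupling again provides a member.\<close>
  moreover have "wasserstein1 M M \<ge> 0"
    unfolding wasserstein1_def using \<open>?D \<in> couplings M M\<close> by (intro cINF_greatest) auto
  ultimately show ?thesis by simp
qed

text \<open>By the modulus estimate with equal actions, every candidate in the infimum is at least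
  \<open>J t x z\<close>. The candidate \<open>(z, t)\<close> attains this value, because both of
  its penalty terms are \<omega> at 0.\<close>

lemma cost_extension_empirical:
  assumes "\<omega> 0 = 0" and t: "t \<in> T" and z: "length z = N - 1" "z \<noteq> []"
    and J: "\<And>t' w. \<lbrakk>t' \<in> T; length w = N - 1\<rbrakk> \<Longrightarrow> \<bar>J t x z - J t' x w\<bar>
        \<le> \<omega> (dist t t') + \<omega> (dist x x) + \<omega> (wasserstein1 (empirical z) (empirical w))"
  shows "cost_extension \<omega> N T J (t, x, empirical z) = J t x z"
proof -
  let ?G = "\<lambda>(w, t'). J t' x w + \<omega> (dist t' t) + \<omega> (wasserstein1 (empirical z) (empirical w))"
  let ?I = "{w. length w = N - 1} \<times> T"
  \<comment> \<open>This bound is used twice: it makes the family bounded below, so that the infimum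
    lies below each candidate, and it bounds the infimum itself from below.\<close>
  have lower: "J t x z \<le> ?G p" if "p \<in> ?I" for p
  proof -
    obtain w t' where p: "p = (w, t')" "length w = N - 1" "t' \<in> T"
      using \<open>p \<in> ?I\<close> by blast
    then show ?thesis
      using J[of t' w] \<open>\<omega> 0 = 0\<close> by (simp add: dist_commute)
  qed
  have "(z, t) \<in> ?I"
    using t z by simp
  moreover have "?G (z, t) = J t x z"
    using \<open>\<omega> 0 = 0\<close> wasserstein1_self[OF empirical_in_borel_probs[OF z(2)]] by simp
  moreover have "bdd_below (?G ` ?I)"
    using lower by (intro bdd_belowI2)
  ultimately have "(INF p \<in> ?I. ?G p) \<le> J t x z"
    by (metis (no_types, lifting) cINF_lower)
  moreover have "J t x z \<le> (INF p \<in> ?I. ?G p)"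
    using lower \<open>(z, t) \<in> ?I\<close> by (intro cINF_greatest) auto
  ultimately show ?thesis
    by (simp add: cost_extension_def)
qed

section \<open>Removing one player from the empirical measure\<close>

lemma length_others:
  "i < length x \<Longrightarrow> length (others i x) = length x - 1"
  by (simp add: others_def)

lemma sum_list_map_others:
  fixes f :: "'a \<Rightarrow> 'b::ab_group_add"
  assumes "i < length x"
  shows "sum_list (map f (others i x)) = sum_list (map f x) - f (x ! i)"
proof -
  have "sum_list (map f x) = sum_list (map f (take i x @ x ! i # drop (Suc i) x))"
    using id_take_nth_drop[OF assms] by simp
  then show ?thesis
    by (simp add: others_def)
qed

text \<open>If \<open>m\<close> is the mean of \<open>f\<close> over all \<open>N\<close> entries
  and \<open>a\<close> is its value at the removed one, the mean over the rest is
  \<open>m + (m - a) / (N - 1)\<close>. The correction vanishes since \<open>m\<close> converges and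
  \<open>a\<close> is bounded. The removed index may vary with \<open>k\<close> in any way.\<close>

lemma limitin_empirical_others:
  fixes x :: "nat \<Rightarrow> 'a::topological_space list"
  assumes comp: "compact (UNIV :: 'a set)"
    and lim: "limitin weak_star (\<lambda>k. empirical (x k)) \<nu> sequentially"
    and len: "filterlim (\<lambda>k. length (x k)) at_top sequentially" "\<And>k. length (x k) \<ge> 2"
    and i: "\<And>k. i k < length (x k)"
  shows "limitin weak_star (\<lambda>k. empirical (others (i k) (x k))) \<nu> sequentially"
  unfolding limitin_weak_star_iff
proof (intro conjI allI impI)
  have others_ne: "others (i k) (x k) \<noteq> []" for k
    using length_others[OF i, of k] len(2)[of k] by auto
  then show "\<forall>\<^sub>F k in sequentially. empirical (others (i k) (x k)) \<in> borel_probs"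
    by (simp add: empirical_in_borel_probs)
  show "\<nu> \<in> borel_probs"
    using lim by (simp add: limitin_weak_star_iff)
  fix f :: "'a \<Rightarrow> real"
  assume f: "continuous_on UNIV f"
  obtain B where B: "\<And>y. \<bar>f y\<bar> \<le> B"
    using continuous_on_UNIV_bounded[OF comp f] by blast
  let ?m = "\<lambda>k. integral\<^sup>L (empirical (x k)) f"
  have m: "?m \<longlonglongrightarrow> integral\<^sup>L \<nu> f"
    using lim f by (simp add: limitin_weak_star_iff)
  have len_real: "filterlim (\<lambda>k. real (length (x k)) - 1) at_top sequentially"
    using filterlim_compose[OF filterlim_real_sequentially len(1)]
      filterlim_tendsto_add_at_top[of "\<lambda>_. -1" "-1" sequentially "\<lambda>k. real (length (x k))"]
    by simp
  have eq: "integral\<^sup>L (empirical (others (i k) (x k))) f =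
      ?m k + (?m k - f (x k ! i k)) * inverse (real (length (x k)) - 1)" for k
  proof -
    have "x k \<noteq> []"
      using len(2)[of k] by auto
    then have "?m k * real (length (x k)) = sum_list (map f (x k))"
      by (simp add: integral_empirical[OF _ f])
    moreover have "integral\<^sup>L (empirical (others (i k) (x k))) f =
        (sum_list (map f (x k)) - f (x k ! i k)) / (real (length (x k)) - 1)"
      using len(2)[of k] unfolding integral_empirical[OF others_ne f] sum_list_map_others[OF i]
        length_others[OF i] by (simp add: of_nat_diff)
    moreover have "real (length (x k)) - 1 \<noteq> 0"
      using len(2)[of k] by auto
    ultimately show ?thesis
      by (simp add: field_simps)
  qed
  have "(\<lambda>k. f (x k ! i k) * inverse (real (length (x k)) - 1)) \<longlonglongrightarrow> 0"
  proof (rule Lim_null_comparison)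
    show "\<forall>\<^sub>F k in sequentially. norm (f (x k ! i k) * inverse (real (length (x k)) - 1))
        \<le> B * inverse (real (length (x k)) - 1)"
    proof (rule always_eventually, rule allI)
      fix k
      have "0 \<le> inverse (real (length (x k)) - 1)"
        using len(2)[of k] by simp
      then show "norm (f (x k ! i k) * inverse (real (length (x k)) - 1))
          \<le> B * inverse (real (length (x k)) - 1)"
        using B[of "x k ! i k"] by (simp add: abs_mult mult_right_mono)
    qed
    show "(\<lambda>k. B * inverse (real (length (x k)) - 1)) \<longlonglongrightarrow> 0"
      using tendsto_mult[OF tendsto_const tendsto_inverse_0_at_top[OF len_real], of B] by simp
  qed
  from tendsto_diff[OF tendsto_mult[OF m tendsto_inverse_0_at_top[OF len_real]] this]
  have "(\<lambda>k. (?m k - f (x k ! i k)) * inverse (real (length (x k)) - 1)) \<longlonglongrightarrow> 0"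
    by (simp add: algebra_simps)
  from tendsto_add[OF m this]
  show "(\<lambda>k. integral\<^sup>L (empirical (others (i k) (x k))) f) \<longlonglongrightarrow> integral\<^sup>L \<nu> f"
    by (simp add: eq)
qed

text \<open>Uniformity over the players is obtained from the statement about one arbitrary sequence
  of indices, by letting \<open>i k\<close> be a worst player at stage \<open>k\<close>.\<close>

lemma eventually_empirical_others:
  fixes x :: "nat \<Rightarrow> 'a::topological_space list"
  assumes "compact (UNIV :: 'a set)"
    and "limitin weak_star (\<lambda>k. empirical (x k)) \<nu> sequentially"
    and "filterlim (\<lambda>k. length (x k)) at_top sequentially" and len: "\<And>k. length (x k) \<ge> 2"
    and W: "openin weak_star W" "\<nu> \<in> W"
  shows "\<forall>\<^sub>F k in sequentially. \<forall>i<length (x k). empirical (others i (x k)) \<in> W"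
proof -
  \<comment> \<open>The worst player is one whose removal leaves \<open>W\<close>, if there is any;
    otherwise any player will do, and one exists because the list is nonempty.\<close>
  have "\<exists>i<length (x k). empirical (others i (x k)) \<in> W \<longrightarrow>
      (\<forall>j<length (x k). empirical (others j (x k)) \<in> W)" for k
  proof (cases "\<forall>j<length (x k). empirical (others j (x k)) \<in> W")
    case True
    have "0 < length (x k)"
      using len[of k] by linarith
    with True show ?thesis by blast
  qed blast
  then obtain i where i: "\<And>k. i k < length (x k)"
    and worst: "\<And>k. empirical (others (i k) (x k)) \<in> W \<Longrightarrow>
      \<forall>j<length (x k). empirical (others j (x k)) \<in> W"
    by metis
  have "\<forall>\<^sub>F k in sequentially. empirical (others (i k) (x k)) \<in> W"
    using limitin_empirical_others[OF assms(1-4) i] W by (auto simp: limitin_def)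
  then show ?thesis
    by (rule eventually_mono) (use worst in blast)
qed

section \<open>Uniformity in type and action by compactness\<close>

text \<open>This is the tube lemma: the difference of \<open>F\<close> at \<nu>' and at \<nu> is
  continuous and vanishes on the slice \<nu>' = \<nu>, whose other factor is the compact space of
  pairs of a type and an action.\<close>

lemma continuous_uniform_in_measure:
  fixes F :: "'t::topological_space \<times> 'x::topological_space \<times> 'x measure \<Rightarrow> real"
  assumes comp: "compact (UNIV :: 't set)" "compact (UNIV :: 'x set)"
    and F: "continuous_map type_action_measure_space euclideanreal F"
    and \<nu>: "\<nu> \<in> borel_probs" and "\<epsilon> > 0"
  obtains W where "openin weak_star W" "\<nu> \<in> W"
    "\<And>t x \<nu>'. \<nu>' \<in> W \<Longrightarrow> \<bar>F (t, x, \<nu>') - F (t, x, \<nu>)\<bar> < \<epsilon>"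
proof -
  \<comment> \<open>The measure is moved to the first coordinate, and type and action are grouped
    into one compact factor, to match the shape of the tube lemma.\<close>
  let ?S = "prod_topology weak_star (euclidean :: ('t \<times> 'x) topology)"
  let ?H = "\<lambda>(m, p). F (fst p, snd p, m) - F (fst p, snd p, \<nu>)"
  have snd_S: "continuous_map ?S euclidean (\<lambda>q. fst (snd q))"
    "continuous_map ?S euclidean (\<lambda>q. snd (snd q))"
    using continuous_map_compose[OF continuous_map_snd, of euclidean euclidean fst weak_star]
      continuous_map_compose[OF continuous_map_snd, of euclidean euclidean snd weak_star]
    by (simp_all add: o_def continuous_on_fst continuous_on_snd)
  have "continuous_map ?S type_action_measure_space (\<lambda>q. (fst (snd q), snd (snd q), fst q))"
    "continuous_map ?S type_action_measure_space (\<lambda>q. (fst (snd q), snd (snd q), \<nu>))"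
    using \<nu> by (auto intro!: continuous_map_pairedI snd_S continuous_map_fst)
  from this[THEN continuous_map_compose, OF F]
  have "continuous_map ?S euclideanreal ?H"
    by (auto simp: o_def case_prod_unfold intro!: continuous_map_diff)
  then have "openin ?S {q \<in> topspace ?S. ?H q \<in> ball 0 \<epsilon>}"
    by (rule openin_continuous_map_preimage) simp
  moreover have "compactin euclidean (UNIV :: ('t \<times> 'x) set)"
    using compact_Times[OF comp] by simp
  moreover have "\<nu> \<in> topspace weak_star"
    using \<nu> by simp
  moreover have "{\<nu>} \<times> UNIV \<subseteq> {q \<in> topspace ?S. ?H q \<in> ball 0 \<epsilon>}"
    using \<nu> \<open>\<epsilon> > 0\<close> by auto
  ultimately have "\<exists>W V. openin weak_star W \<and> openin euclidean V \<and> \<nu> \<in> W \<and> UNIV \<subseteq> V \<and>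
      W \<times> V \<subseteq> {q \<in> topspace ?S. ?H q \<in> ball 0 \<epsilon>}"
    by (rule tube_lemma_right)
  then obtain W V where W: "openin weak_star W" "\<nu> \<in> W" "UNIV \<subseteq> V"
    "W \<times> V \<subseteq> {q \<in> topspace ?S. ?H q \<in> ball 0 \<epsilon>}"
    by (elim exE conjE)
  have "\<bar>F (t, x, \<nu>') - F (t, x, \<nu>)\<bar> < \<epsilon>" if "\<nu>' \<in> W" for t x \<nu>'
  proof -
    have "(\<nu>', (t, x)) \<in> W \<times> V"
      using that W(3) by auto
    then have "(\<nu>', (t, x)) \<in> {q \<in> topspace ?S. ?H q \<in> ball 0 \<epsilon>}"
      by (rule subsetD[OF W(4)])
    then show ?thesis by simp
  qed
  then show thesis
    by (rule that[OF W(1,2)])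
qed

lemma bdd_below_continuous:
  fixes f :: "'a::topological_space \<Rightarrow> real"
  assumes "compact (UNIV :: 'a set)" "continuous_on UNIV f"
  shows "bdd_below (range f)"
  using assms by (intro bounded_imp_bdd_below compact_imp_bounded compact_continuous_image)

text \<open>On the compact product \<open>G\<close> is uniformly continuous, so nearby parameters
  give functions of \<open>y\<close> that are uniformly close, and hence close infima.\<close>

lemma continuous_on_INF_compact:
  fixes G :: "'t::metric_space \<Rightarrow> 'x::metric_space \<Rightarrow> real"
  assumes comp: "compact (UNIV :: 't set)" "compact (UNIV :: 'x set)"
    and G: "continuous_on UNIV (\<lambda>p. G (fst p) (snd p))"
  shows "continuous_on UNIV (\<lambda>t. INF y. G t y)"
proof -
  have bdd: "bdd_below (range (G t))" for t :: 't
  proof -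
    have "continuous_on UNIV ((\<lambda>p. G (fst p) (snd p)) \<circ> (\<lambda>y. (t, y)))"
      by (intro continuous_on_compose continuous_intros continuous_on_subset[OF G]) auto
    then show ?thesis
      using bdd_below_continuous[OF comp(2)] by (simp add: o_def)
  qed
  have "uniformly_continuous_on UNIV (\<lambda>p. G (fst p) (snd p))"
    using compact_Times[OF comp] G by (intro compact_uniformly_continuous) auto
  note unif = this[unfolded uniformly_continuous_on_def, rule_format, simplified]
  have "uniformly_continuous_on UNIV (\<lambda>t. INF y. G t y)"
    unfolding uniformly_continuous_on_def
  proof (intro allI impI)
    fix e :: real assume "e > 0"
    then obtain d where "d > 0"
      and d: "\<And>p q. dist q p < d \<Longrightarrow> dist (G (fst q) (snd q)) (G (fst p) (snd p)) < e / 2"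
      using unif[of "e / 2"] by auto
    \<comment> \<open>The one-sided estimate is enough, since \<open>s\<close> and \<open>t\<close>
      may be exchanged.\<close>
    have le: "(INF y. G s y) \<le> (INF y. G t y) + e / 2" if "dist s t < d" for s t :: 't
    proof -
      have "(INF y. G s y) - e / 2 \<le> G t y" for y
      proof -
        have "\<bar>G s y - G t y\<bar> < e / 2"
          using d[of "(s, y)" "(t, y)"] that by (simp add: dist_Pair_Pair dist_real_def)
        moreover have "(INF y. G s y) \<le> G s y"
          using bdd by (rule cINF_lower) simp
        ultimately show ?thesis by linarith
      qed
      then have "(INF y. G s y) - e / 2 \<le> (INF y. G t y)"
        by (intro cINF_greatest) auto
      then show ?thesis by simp
    qed
    show "\<exists>d>0. \<forall>x\<in>UNIV. \<forall>x'\<in>UNIV. dist x' x < d \<longrightarrow>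
        dist (INF y. G x' y) (INF y. G x y) < e"
    proof (intro exI conjI ballI impI)
      fix s t :: 't assume "dist t s < d"
      then show "dist (INF y. G t y) (INF y. G s y) < e"
        using le[of s t] le[of t s] \<open>e > 0\<close> by (simp add: dist_commute dist_real_def)
    qed fact
  qed
  then show ?thesis
    by (rule uniformly_continuous_imp_continuous)
qed

section \<open>Marginals of the limit measure\<close>

text \<open>Integrating \<open>f\<close> against the empirical measure of the images is integrating
  \<open>f\<close> after \<open>g\<close> against the original one. Both sides converge, so
  uniqueness of limits makes all continuous test functions agree.\<close>

lemma limitin_weak_star_marginal:
  fixes g :: "'a::metric_space \<Rightarrow> 'b::metric_space"
  assumes g: "continuous_on UNIV g"
    and \<gamma>: "limitin weak_star (\<lambda>k. empirical (z k)) \<gamma> sequentially"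
    and \<mu>: "limitin weak_star (\<lambda>k. empirical (map g (z k))) \<mu> sequentially"
    and z: "\<And>k. z k \<noteq> []"
  shows "distr \<gamma> borel g = \<mu>"
proof (rule borel_probs_eqI)
  have \<gamma>_prob: "\<gamma> \<in> borel_probs"
    using \<gamma> by (simp add: limitin_weak_star_iff)
  show "distr \<gamma> borel g \<in> borel_probs" "\<mu> \<in> borel_probs"
    using distr_borel_probs(1)[OF \<gamma>_prob g] \<mu> by (simp_all add: limitin_weak_star_iff)
  fix f :: "'b \<Rightarrow> real" assume f: "continuous_on UNIV f"
  have fg: "continuous_on UNIV (\<lambda>p. f (g p))"
    using continuous_on_compose2[OF f g] by simp
  have "integral\<^sup>L (empirical (map g (z k))) f = integral\<^sup>L (empirical (z k)) (\<lambda>p. f (g p))" for k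
    using integral_empirical[OF _ f, of "map g (z k)"] integral_empirical[OF z fg, of k] z[of k]
    by (simp add: o_def)
  moreover have "(\<lambda>k. integral\<^sup>L (empirical (map g (z k))) f) \<longlonglongrightarrow> integral\<^sup>L \<mu> f"
    using \<mu> f by (simp add: limitin_weak_star_iff)
  moreover have "(\<lambda>k. integral\<^sup>L (empirical (z k)) (\<lambda>p. f (g p))) \<longlonglongrightarrow> integral\<^sup>L \<gamma> (\<lambda>p. f (g p))"
    using \<gamma> fg by (simp add: limitin_weak_star_iff)
  ultimately show "integral\<^sup>L (distr \<gamma> borel g) f = integral\<^sup>L \<mu> f"
    using distr_borel_probs(2)[OF \<gamma>_prob g f] by (simp add: LIMSEQ_unique)
qed

section \<open>Passage to the limit in the Nash condition\<close>

theorem theorem4p1: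
  fixes \<omega> :: "real \<Rightarrow> real"
    and \<theta> :: "nat \<Rightarrow> 't::metric_space list"
    and J :: "nat \<Rightarrow> 't \<Rightarrow> 'x::metric_space \<Rightarrow> 'x list \<Rightarrow> real"
    and xbar :: "nat \<Rightarrow> 'x list"
    and r :: "nat \<Rightarrow> nat"
    and \<mu> :: "'t measure" and \<nu> :: "'x measure" and \<gamma> :: "('t \<times> 'x) measure"
    and F :: "'t \<times> 'x \<times> 'x measure \<Rightarrow> real"
  assumes "compact (UNIV :: 'x set)" and "compact (UNIV :: 't set)"
    and "modulus_of_continuity \<omega>"
    and "\<And>N. N \<ge> 2 \<Longrightarrow> length (\<theta> N) = N"
    and J_symmetric: "\<And>N t x z w. \<lbrakk>N \<ge> 2; t \<in> set (\<theta> N); length z = N - 1; mset w = mset z\<rbrakk>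
           \<Longrightarrow> J N t x w = J N t x z"
    and J_modulus: "\<And>N t t' x y z w.
           \<lbrakk>N \<ge> 2; t \<in> set (\<theta> N); t' \<in> set (\<theta> N); length z = N - 1; length w = N - 1\<rbrakk>
           \<Longrightarrow> \<bar>J N t x z - J N t' y w\<bar>
               \<le> \<omega> (dist t t') + \<omega> (dist x y) + \<omega> (wasserstein1 (empirical z) (empirical w))"
    and nash: "\<And>N. N \<ge> 2 \<Longrightarrow>
           nash_equilibrium N (\<lambda>_. UNIV) (\<lambda>i y z. J N (\<theta> N ! i) y z) (xbar N)"
    and subsequence: "strict_mono r" "\<And>k. r k \<ge> 2"
    and "limitin weak_star (\<lambda>k. empirical (\<theta> (r k))) \<mu> sequentially"
    and "limitin weak_star (\<lambda>k. empirical (xbar (r k))) \<nu> sequentially"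
    and "limitin weak_star (\<lambda>k. empirical (zip (\<theta> (r k)) (xbar (r k)))) \<gamma> sequentially"
    and "conv_in_C type_action_measure_space
           (\<lambda>k. cost_extension \<omega> (r k) (set (\<theta> (r k))) (J (r k))) F"
  shows "cournot_nash_equilibrium F \<mu> \<gamma>"
proof -
  note lens = assms(4)
  have \<omega>0: "\<omega> 0 = 0"
    using assms(3) by (simp add: modulus_of_continuity_def)
  note lim_\<mu> = assms(10) and lim_\<nu> = assms(11) and lim_\<gamma> = assms(12)
  let ?x = "\<lambda>k. xbar (r k)" and ?\<theta> = "\<lambda>k. \<theta> (r k)"
  let ?F = "\<lambda>k. cost_extension \<omega> (r k) (set (?\<theta> k)) (J (r k))"
  have len_x: "length (?x k) = r k" and len_\<theta>: "length (?\<theta> k) = r k" for k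
    using nash[OF subsequence(2)] lens[OF subsequence(2)] by (auto simp: nash_equilibrium_def)
  have zip_ne: "zip (?\<theta> k) (?x k) \<noteq> []" for k
    using len_x[of k] len_\<theta>[of k] subsequence(2)[of k] by (auto simp: zip_eq_Nil_iff)
  have F: "continuous_map type_action_measure_space euclideanreal F"
    and unif: "uniform_limit (topspace type_action_measure_space) ?F F sequentially"
    using assms(13) by (simp_all add: conv_in_C_def)
  have \<nu>: "\<nu> \<in> borel_probs" and \<gamma>: "\<gamma> \<in> borel_probs"
    using lim_\<nu> lim_\<gamma> by (simp_all add: limitin_weak_star_iff)
  have fst: "distr \<gamma> borel fst = \<mu>"
    using lim_\<mu> zip_ne len_x len_\<theta>
    by (intro limitin_weak_star_marginal[OF _ lim_\<gamma>]) (auto intro: continuous_intros)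
  \<comment> \<open>The equilibrium condition evaluates \<open>F\<close> at the second marginal of
    \<gamma>, which is hereby \<nu>. Types and actions have equal length, so projecting the zipped
    list returns the full profile.\<close>
  have snd: "distr \<gamma> borel snd = \<nu>"
    using lim_\<nu> zip_ne len_x len_\<theta>
    by (intro limitin_weak_star_marginal[OF _ lim_\<gamma>]) (auto intro: continuous_intros)

  let ?G = "\<lambda>t x. F (t, x, \<nu>)"
  let ?g = "\<lambda>p. ?G (fst p) (snd p) - (INF y. ?G (fst p) y)"
  have G: "continuous_on UNIV (\<lambda>p. ?G (fst p) (snd p))"
  proof -
    have "continuous_map euclidean type_action_measure_space (\<lambda>p. (fst p, snd p, \<nu>))"
      using \<nu> by (intro continuous_map_pairedI) (auto intro: continuous_intros)
    from continuous_map_compose[OF this F] show ?thesis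
      by (simp add: o_def)
  qed
  have G_snd: "continuous_on UNIV (?G t)" for t
    using continuous_on_compose2[OF G, of UNIV "\<lambda>y. (t, y)"] by (simp add: continuous_intros)
  have g: "continuous_on UNIV ?g"
    by (intro continuous_on_diff G
        continuous_on_compose2[OF continuous_on_INF_compact[OF assms(2,1) G]] continuous_intros) auto
  have g_nonneg: "?g p \<ge> 0" for p
    using cINF_lower[OF bdd_below_continuous[OF assms(1) G_snd]] by simp
  have int_g: "integrable \<gamma> ?g"
    using compact_Times[OF assms(2,1)] g \<gamma> by (intro integrable_continuous_borel_probs) auto

  have "integral\<^sup>L \<gamma> ?g \<le> e" if "e > 0" for e
  proof -
    \<comment> \<open>One quarter pays for replacing the extended cost by \<open>F\<close>, another
      for replacing the measure of the opponents by \<nu>. The resulting error \<open>e / 2\<close>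
      occurs twice, at the equilibrium action and at the deviation.\<close>
    have e: "e / 4 > 0"
      using that by simp
    obtain W where W: "openin weak_star W" "\<nu> \<in> W"
      and W_close: "\<And>t x \<nu>'. \<nu>' \<in> W \<Longrightarrow> \<bar>F (t, x, \<nu>') - F (t, x, \<nu>)\<bar> < e / 4"
      using continuous_uniform_in_measure[OF assms(2,1) F \<nu> e] by blast
    have ev_W: "\<forall>\<^sub>F k in sequentially. \<forall>i<length (?x k). empirical (others i (?x k)) \<in> W"
      using subsequence filterlim_subseq[OF subsequence(1)] len_x
      by (intro eventually_empirical_others[OF assms(1) lim_\<nu> _ _ W]) auto
    have ev_F: "\<forall>\<^sub>F k in sequentially. \<forall>p\<in>topspace type_action_measure_space.
        dist (?F k p) (F p) < e / 4"
      using unif e by (rule uniform_limitD)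
    have "\<forall>\<^sub>F k in sequentially. integral\<^sup>L (empirical (zip (?\<theta> k) (?x k))) ?g \<le> e"
      using ev_W ev_F
    proof eventually_elim
      case (elim k)
      have g_le: "?g (?\<theta> k ! i, ?x k ! i) \<le> e" if i: "i < r k" for i
      proof -
        let ?z = "others i (?x k)" and ?t = "?\<theta> k ! i"
        have z: "length ?z = r k - 1" "?z \<noteq> []"
          using length_others[of i "?x k"] i len_x[of k] subsequence(2)[of k] by auto
        have t: "?t \<in> set (?\<theta> k)"
          using i len_\<theta>[of k] by simp
        \<comment> \<open>The opponents stay fixed while the action \<open>x\<close> is arbitrary,
          so the same estimate covers every deviation.\<close>
        have close: "\<bar>J (r k) ?t x ?z - ?G ?t x\<bar> < e / 2" for x
        proof -
          have "?F k (?t, x, empirical ?z) = J (r k) ?t x ?z"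
            by (intro cost_extension_empirical[where \<omega> = \<omega>, OF \<omega>0 t z]
                J_modulus[OF subsequence(2) t _ z(1)])
          moreover have "dist (?F k (?t, x, empirical ?z)) (F (?t, x, empirical ?z)) < e / 4"
            using elim(2) empirical_in_borel_probs[OF z(2)] by simp
          moreover have "\<bar>F (?t, x, empirical ?z) - F (?t, x, \<nu>)\<bar> < e / 4"
            using elim(1) i len_x[of k] by (intro W_close) auto
          ultimately show ?thesis
            unfolding dist_real_def by linarith
        qed
        have "?G ?t (?x k ! i) - e \<le> ?G ?t y" for y
        proof -
          have "J (r k) ?t (?x k ! i) ?z \<le> J (r k) ?t y ?z"
            using nash[OF subsequence(2)[of k]] i by (simp add: nash_equilibrium_def)
          then show ?thesis
            using close[of "?x k ! i"] close[of y] by linarith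
        qed
        then have "?G ?t (?x k ! i) - e \<le> (INF y. ?G ?t y)"
          by (intro cINF_greatest) auto
        then show ?thesis by simp
      qed
      have "sum_list (map ?g (zip (?\<theta> k) (?x k))) \<le> sum_list (map (\<lambda>_. e) (zip (?\<theta> k) (?x k)))"
      proof (rule sum_list_mono)
        fix p assume "p \<in> set (zip (?\<theta> k) (?x k))"
        then obtain i where "p = (?\<theta> k ! i, ?x k ! i)" "i < r k"
          by (metis in_set_conv_nth len_x len_\<theta> length_zip min.idem nth_zip)
        then show "?g p \<le> e"
          using g_le by blast
      qed
      then have "sum_list (map ?g (zip (?\<theta> k) (?x k))) \<le> e * r k"
        by (simp add: sum_list_triv len_x len_\<theta> mult.commute)
      then show ?case
        unfolding integral_empirical[OF zip_ne g] using subsequence(2)[of k]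
        by (simp add: len_x len_\<theta> divide_le_eq)
    qed
    \<comment> \<open>The regret \<open>?g\<close> is itself a continuous test function, so the
      bound on its averages passes to the limit.\<close>
    moreover have "(\<lambda>k. integral\<^sup>L (empirical (zip (?\<theta> k) (?x k))) ?g) \<longlonglongrightarrow> integral\<^sup>L \<gamma> ?g"
      using lim_\<gamma> g unfolding limitin_weak_star_iff by blast
    ultimately show ?thesis
      by (intro tendsto_upperbound) auto
  qed
  then have "integral\<^sup>L \<gamma> ?g \<le> 0"
    using field_le_epsilon[of "integral\<^sup>L \<gamma> ?g" 0] by (simp only: add_0)
  moreover have "integral\<^sup>L \<gamma> ?g \<ge> 0"
    by (rule integral_nonneg_AE) (rule AE_I2, rule g_nonneg)
  ultimately have "integral\<^sup>L \<gamma> ?g = 0"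
    by (rule antisym)
  then have "AE p in \<gamma>. ?g p = 0"
    using integral_nonneg_eq_0_iff_AE[OF int_g AE_I2[OF g_nonneg]] by (rule iffD1[rotated])
  moreover have "{(t, x). ?G t x = (INF y. ?G t y)} = {p \<in> space \<gamma>. ?g p = 0}"
    using \<gamma> sets_eq_imp_space_eq[of \<gamma> borel] by (auto simp: borel_probs_def)
  moreover have "prob_space \<gamma>"
    using \<gamma> by (simp add: borel_probs_def)
  \<comment> \<open>Measurability of the zero set is what turns the almost-everywhere statement into
    measure 1.\<close>
  moreover have "{p \<in> space \<gamma>. ?g p = 0} \<in> sets \<gamma>"
    using borel_measurable_integrable[OF int_g] by measurable
  ultimately have "measure \<gamma> {(t, x). ?G t x = (INF y. ?G t y)} = 1"
    by (simp add: prob_space.prob_Collect_eq_1)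
  then show ?thesis
    using \<gamma> fst snd by (simp add: cournot_nash_equilibrium_def Let_def)
qed

end
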